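(* For any $\Delta\ge 2$ and $0\le\alpha<\pi/2$, there exists an open set $U_{\Delta,\alpha}\subseteq\mathbb{C}$ containing the interval $[1,\infty)$, such that if $G$ is a graph of maximum degree at most $\Delta$, then for $b\in U_{\Delta,\alpha}$ and $\lambda\in\{z\in\mathbb{C} : |\arg(z)|<\pi-2\alpha\}$ we have $Z_{L(G)}(\lambda,b)\neq 0$. In particular, $Z_{L(G)}(1,b)\neq 0$ for all $b\in U_{\Delta,\alpha}$.
   Context: For a finite simple graph $H=(V,E)$ and $z,b\in\mathbb{C}$, the partition function of the Ising model is $Z_H(z,b)=\sum_{U\subseteq V} z^{|U|}\, b^{|\delta(U)|}$, where $\delta(U)$ denotes the set of edges of $H$ with one endpoint in $U$ and one endpoint in $V\setminus U$. The line graph $L(G)$ of a graph $G$ is the graph whose vertices are the edges of $G$, two edges of $G$ being adjacent in $L(G)$ if they share a common vertex. Graphs are finite and simple. Here $\arg(z)\in(-\pi,\pi]$ is the principal argument of a nonzero complex number $z$.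
   Formalization: The formal theorem assumes 0<α instead of 0≤α: for α=0 the claim is false, since the line graph of the path with two edges is K_2, and Z=1+2bλ+λ² has non-real zeros for b<1 arbitrarily close to 1. *)

theory Defs
  imports "HOL-Analysis.Analysis"
begin

type_synonym 'a ugraph = "'a set \<times> 'a set set"

abbreviation vertices :: "'a ugraph \<Rightarrow> 'a set" where
  "vertices G \<equiv> fst G"

abbreviation edges :: "'a ugraph \<Rightarrow> 'a set set" where
  "edges G \<equiv> snd G"

definition finite_simple_graph :: "'a ugraph \<Rightarrow> bool" where
  "finite_simple_graph G \<longleftrightarrow>
     finite (vertices G) \<and> (\<forall>e \<in> edges G. e \<subseteq> vertices G \<and> card e = 2)"

definition vertex_degree :: "'a ugraph \<Rightarrow> 'a \<Rightarrow> nat" where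
  "vertex_degree G v = card {e \<in> edges G. v \<in> e}"

definition edge_boundary :: "'a ugraph \<Rightarrow> 'a set \<Rightarrow> 'a set set" where
  "edge_boundary G U = {e \<in> edges G. \<exists>u v. e = {u, v} \<and> u \<in> U \<and> v \<in> vertices G - U}"

definition ising_partition :: "'a ugraph \<Rightarrow> complex \<Rightarrow> complex \<Rightarrow> complex" where
  "ising_partition G z b =
     (\<Sum>U \<in> Pow (vertices G). z ^ card U * b ^ card (edge_boundary G U))"

definition line_graph :: "'a ugraph \<Rightarrow> 'a set ugraph" where
  "line_graph G =
     (edges G, {{e, f} | e f. e \<in> edges G \<and> f \<in> edges G \<and> e \<noteq> f \<and> e \<inter> f \<noteq> {}})"

text \<open>
  \<^const>\<open>Arg\<close> is the principal argument with values in \<open>(-pi, pi]\<close>. The library sets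
  \<open>Arg 0 = 0\<close>, so 0, which has no argument, is excluded explicitly.
\<close>

definition arg_sector :: "real \<Rightarrow> complex set" where
  "arg_sector t = {z. z \<noteq> 0 \<and> \<bar>Arg z\<bar> < t}"

lemma finite_simple_graph_line_graph:
  assumes "finite_simple_graph G"
  shows "finite_simple_graph (line_graph G)"
proof -
  have "edges G \<subseteq> Pow (vertices G)"
    using assms by (auto simp: finite_simple_graph_def)
  then have "finite (edges G)"
    using assms by (auto simp: finite_simple_graph_def intro: finite_subset)
  then show ?thesis
    by (auto simp: finite_simple_graph_def line_graph_def card_insert_if)
qed

text \<open>
  No open set of edge parameters works for the angle \<open>\<alpha> = 0\<close>, that is, for all
  fields off the closed negative real axis: the line graph of the path with two edges is a single
  edge, whose partition function \<open>1 + 2 b z + z^2\<close> has for \<open>0 < b < 1\<close> two zeros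
  on the unit circle that are not real. Hence the angle in the main theorem is positive.
\<close>

lemma ising_line_graph_P3:
  "ising_partition (line_graph ({0, 1, 2::nat}, {{0, 1}, {1, 2}})) z b = 1 + 2 * b * z + z\<^sup>2"
proof -
  define p q where "p = {0, 1::nat}" and "q = {1, 2::nat}"
  have pq: "p \<noteq> q" "p \<inter> q \<noteq> {}"
    by (auto simp: p_def q_def doubleton_eq_iff)
  have L: "line_graph ({0, 1, 2::nat}, {{0, 1}, {1, 2}}) = ({p, q}, {{p, q}})"
    unfolding line_graph_def p_def[symmetric] q_def[symmetric] using pq by auto
  have d: "edge_boundary ({p, q}, {{p, q}}) {} = {}"
    "edge_boundary ({p, q}, {{p, q}}) {p} = {{p, q}}"
    "edge_boundary ({p, q}, {{p, q}}) {q} = {{p, q}}"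
    "edge_boundary ({p, q}, {{p, q}}) {p, q} = {}"
    using pq by (auto simp: edge_boundary_def)
  have P: "Pow {p, q} = {{}, {p}, {q}, {p, q}}"
    by auto
  have "ising_partition ({p, q}, {{p, q}}) z b = 1 + 2 * b * z + z\<^sup>2"
    using pq by (simp add: ising_partition_def P d card_insert_if power2_eq_square)
  then show ?thesis
    unfolding L .
qed

lemma no_open_set_for_angle_zero:
  "\<not> (\<exists>U. open U \<and> complex_of_real ` {1..} \<subseteq> U \<and>
         (\<forall>G :: nat ugraph. finite_simple_graph G \<and> (\<forall>v \<in> vertices G. vertex_degree G v \<le> 2) \<longrightarrow>
            (\<forall>b \<in> U. \<forall>z \<in> arg_sector (pi - 2 * 0). ising_partition (line_graph G) z b \<noteq> 0)))"
proof
  assume "\<exists>U. open U \<and> complex_of_real ` {1..} \<subseteq> U \<and>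
         (\<forall>G :: nat ugraph. finite_simple_graph G \<and> (\<forall>v \<in> vertices G. vertex_degree G v \<le> 2) \<longrightarrow>
            (\<forall>b \<in> U. \<forall>z \<in> arg_sector (pi - 2 * 0). ising_partition (line_graph G) z b \<noteq> 0))"
  then obtain U where U: "open U" "complex_of_real ` {1..} \<subseteq> U"
    and nz: "\<And>G :: nat ugraph. \<And>b z. finite_simple_graph G \<Longrightarrow> \<forall>v \<in> vertices G. vertex_degree G v \<le> 2 \<Longrightarrow>
            b \<in> U \<Longrightarrow> z \<in> arg_sector pi \<Longrightarrow> ising_partition (line_graph G) z b \<noteq> 0"
    by auto
  let ?G = "({0, 1, 2::nat}, {{0, 1}, {1, 2}})"
  have "1 \<in> U"
    using U(2) by (force simp: image_iff)
  then obtain e where e: "e > 0" "ball 1 e \<subseteq> U"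
    using U(1) open_contains_ball by blast
  define t :: real where "t = 1 - min (e / 2) (1 / 2)"
  have t: "0 < t" "t < 1" "1 - t < e"
    using e(1) by (auto simp: t_def min_def)
  have "dist 1 (complex_of_real t) = 1 - t"
    using t by (metis abs_of_pos diff_gt_0_iff_gt dist_norm norm_of_real of_real_1 of_real_diff)
  then have tU: "complex_of_real t \<in> U"
    using e(2) t(3) by auto
  define z where "z = Complex (- t) (sqrt (1 - t\<^sup>2))"
  have t2: "t\<^sup>2 < 1"
    using t by (simp add: power_less_one_iff)
  have z0: "z \<noteq> 0"
    using t by (auto simp: z_def complex_eq_iff)
  have "Im z > 0"
    using t2 by (simp add: z_def)
  then have "\<bar>Arg z\<bar> < pi"
    using Arg_lt_pi[of z] by auto
  then have zs: "z \<in> arg_sector pi"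
    using z0 by (simp add: arg_sector_def)
  have G: "finite_simple_graph ?G"
    by (auto simp: finite_simple_graph_def card_insert_if)
  have deg: "vertex_degree ?G v \<le> 2" for v
  proof -
    have "vertex_degree ?G v \<le> card {{0, 1::nat}, {1, 2}}"
      unfolding vertex_degree_def by (rule card_mono) auto
    also have "\<dots> \<le> 2"
      by (simp add: card_insert_if)
    finally show ?thesis .
  qed
  have "1 + 2 * complex_of_real t * z + z\<^sup>2 = 0"
  proof -
    have "sqrt (1 - t\<^sup>2) * sqrt (1 - t\<^sup>2) = 1 - t\<^sup>2"
      using t2 by simp
    then show ?thesis
      by (simp add: z_def complex_eq_iff power2_eq_square algebra_simps)
  qed
  then show False
    using nz[OF G _ tU zs] deg ising_line_graph_P3[of z "complex_of_real t"] by simp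
qed

end

theory Submission
  imports Defs "HOL-Computational_Algebra.Fundamental_Theorem_Algebra" "HOL-Real_Asymp.Real_Asymp"
begin

text \<open>
  A set \<open>F\<close> of edges of \<open>G\<close> cuts, at each vertex \<open>v\<close> of degree \<open>d\<close>, exactly \<open>k (d - k)\<close> edges of
  the clique that \<open>v\<close> contributes to the line graph, where \<open>k\<close> is the number of edges of \<open>F\<close> at
  \<open>v\<close>. The partition function of the line graph is therefore a sum over \<open>F\<close> of
  \<open>z ^ card F\<close> times a product of local vertex weights \<open>b ^ (k (d - k))\<close>
  (\<open>ising_partition_line_graph\<close>). If \<open>c\<^sup>2 = z\<close>, the factor \<open>z ^ card F\<close> can also be distributed
  over the vertices, as \<open>c ^ k\<close>, because each edge has two ends.

  Sums of this shape fall under Wagner's method (\<open>wagner_half_plane\<close>). Give each half-edge its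
  own variable; the product over the vertices of the symmetric multiaffine polynomials with
  coefficients \<open>u v k\<close> does not vanish on a half-plane as soon as each univariate key polynomial
  \<open>\<Sum>k. (d choose k) u v k y^k\<close> does not, by the Grace-Walsh-Szego theorem
  (\<open>grace_walsh_szego_half_plane\<close>). Asano contraction then forces the two halves of every edge
  to be both chosen or both omitted, without creating a zero, provided that the half-plane
  contains 0 in its interior (\<open>asano_contraction\<close>).

  It remains to study the key polynomial. With \<open>x = c y\<close> it is
  \<open>\<Sum>k. (d choose k) b^(k (d - k)) x^k\<close>, the Ising partition function of the complete graph on
  \<open>d\<close> vertices. For real \<open>b \<ge> 1\<close> it is a limit of polynomials with only negative
  real zeros: up to rescaling \<open>x\<close>, the weights are the binomial coefficients times a Gaussian
  \<open>b^(-k\<^sup>2)\<close>, which is a limit of powers \<open>cos (k \<epsilon>) ^ N\<close>, and multiplying the coefficients by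
  \<open>cos (k \<epsilon>)\<close> preserves negative zeros (\<open>neg_rooted_cos_multiplier\<close>). A polynomial with
  nonnegative coefficients and negative zeros satisfies \<open>\<bar>p x\<bar> \<ge> s^d p \<bar>x\<bar>\<close> for every \<open>x\<close> in a
  sector away from the negative axis, with \<open>s\<close> depending on the sector only. This bound passes to
  the limit, and it dominates termwise the effect of a small relative change of the powers of
  \<open>b\<close> that occur; the parameters \<open>b\<close> so close to the ray \<open>[1, \<infinity>)\<close> form the open set
  \<open>edge_region\<close>.

  Finally, \<open>\<bar>Arg z\<bar> < pi - 2 \<alpha>\<close> says that \<open>c = csqrt z\<close> has an argument of modulus less than
  \<open>pi / 2 - \<alpha>\<close>, so that \<open>c y\<close> stays in such a sector when \<open>Re y \<ge> 0\<close>. The key polynomials for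
  \<open>d \<le> \<Delta>\<close> have finitely many zeros in all, hence the closed right half-plane on which they do
  not vanish can be enlarged a little, as the contraction demands.
\<close>

section \<open>The Grace-Walsh-Szego theorem for half-planes\<close>


lemma sum_Pow_insert:
  assumes "finite A" "a \<notin> A"
  shows "(\<Sum>S\<in>Pow (insert a A). f S) = (\<Sum>S\<in>Pow A. f S + f (insert a S))"
proof -
  have "(\<Sum>S\<in>Pow (insert a A). f S) = (\<Sum>S\<in>Pow A. f S) + (\<Sum>S\<in>insert a ` Pow A. f S)"
    unfolding Pow_insert using assms by (intro sum.union_disjoint) auto
  also have "(\<Sum>S\<in>insert a ` Pow A. f S) = (\<Sum>S\<in>Pow A. f (insert a S))"
    using assms(2) by (subst sum.reindex) (auto simp: inj_on_def)
  finally show ?thesis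
    by (simp add: sum.distrib)
qed

text \<open>
  The condition \<open>c \<bar>v\<bar>\<^sup>2 \<le> m Re v\<close> says that \<open>v / m\<close> lies in the closed disc with diameter
  \<open>[0, 1 / c]\<close>. So this is convexity of that disc, in the form of adding one more
  point to a sum of \<open>m\<close> points.
\<close>
lemma norm_sum_weighted:
  fixes v w :: complex
  assumes c: "c > 0" and v: "c * (norm v)\<^sup>2 \<le> real m * Re v" and w: "c * (norm w)\<^sup>2 \<le> Re w"
  shows "c * (norm (w + v))\<^sup>2 \<le> (real m + 1) * Re (w + v)"
proof (cases "m = 0")
  case True
  then have "c * (norm v)\<^sup>2 \<le> 0"
    using v by simp
  then have "v = 0"
    using c by (simp add: mult_le_0_iff)
  then show ?thesis
    using True w by simp
next
  case False
  \<comment> \<open>this square is the defect in the convexity of the squared norm\<close>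
  have "0 \<le> (norm (v - of_nat m * w))\<^sup>2"
    by simp
  then have "real m * (norm (w + v))\<^sup>2 \<le> (real m + 1) * ((norm v)\<^sup>2 + real m * (norm w)\<^sup>2)"
    unfolding cmod_power2 by (simp add: power2_eq_square algebra_simps)
  then have "c * (real m * (norm (w + v))\<^sup>2) \<le> c * ((real m + 1) * ((norm v)\<^sup>2 + real m * (norm w)\<^sup>2))"
    using c by (intro mult_left_mono) auto
  also have "\<dots> = (real m + 1) * (c * (norm v)\<^sup>2 + real m * (c * (norm w)\<^sup>2))"
    by (simp add: algebra_simps)
  also have "\<dots> \<le> (real m + 1) * (real m * Re v + real m * Re w)"
    using v w by (intro mult_left_mono add_mono) auto
  finally have "real m * (c * (norm (w + v))\<^sup>2) \<le> real m * ((real m + 1) * Re (w + v))"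
    by (simp add: algebra_simps)
  then show ?thesis
    using False by simp
qed

text \<open>
  The logarithmic derivative is the sum of \<open>1 / (z - r)\<close> over the zeros \<open>r\<close>. Each \<open>z - r\<close> has
  real part at least \<open>Re z - a\<close>, so each summand lies in the disc with diameter
  \<open>[0, 1 / (Re z - a)]\<close>, and so does their mean.
\<close>
lemma log_deriv_in_disc:
  fixes p :: "complex poly"
  assumes "\<And>w. Re w > a \<Longrightarrow> poly p w \<noteq> 0" and z: "Re z > a"
  shows "(Re z - a) * (norm (poly (pderiv p) z / poly p z))\<^sup>2
           \<le> real (degree p) * Re (poly (pderiv p) z / poly p z)"
  using assms(1)
proof (induction "degree p" arbitrary: p)
  case 0
  then obtain k where "p = [:k:]"
    by (metis degree_eq_zeroE)
  then show ?case
    by simp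
next
  case (Suc m)
  then obtain r where r: "poly p r = 0"
    using fundamental_theorem_of_algebra[of p] by (auto simp: constant_degree)
  then obtain q where p: "p = [:-r, 1:] * q"
    by (metis dvdE poly_eq_0_iff_dvd)
  have q0: "q \<noteq> 0"
    using Suc.hyps(2) p by auto
  then have deg: "degree p = Suc (degree q)"
    unfolding p by (subst degree_mult_eq) auto
  have Rr: "Re r \<le> a"
    using Suc.prems r by force
  have qn: "\<And>w. Re w > a \<Longrightarrow> poly q w \<noteq> 0"
    using Suc.prems p by auto
  let ?v = "poly (pderiv q) z / poly q z" and ?w = "inverse (z - r)"
  have zr: "z \<noteq> r"
    using Rr z by auto
  have qz: "poly q z \<noteq> 0"
    using qn z by auto
  have "poly (pderiv p) z = poly q z + (z - r) * poly (pderiv q) z"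
    unfolding p pderiv_mult by (simp add: pderiv_pCons algebra_simps)
  then have split: "poly (pderiv p) z / poly p z = ?w + ?v"
    using zr qz by (simp add: p field_simps)
  have IH: "(Re z - a) * (norm ?v)\<^sup>2 \<le> real (degree q) * Re ?v"
    using Suc.hyps deg qn by auto
  have "(Re z - a) * (norm ?w)\<^sup>2 \<le> Re (z - r) * (norm ?w)\<^sup>2"
    using Rr by (intro mult_right_mono) auto
  also have "\<dots> = Re ?w"
    by (simp add: norm_inverse cmod_power2 power_inverse divide_inverse)
  finally show ?case
    unfolding split deg using norm_sum_weighted[OF _ IH, of ?w] z by (simp add: add.commute)
qed

text \<open>
  Laguerre's theorem. A zero of the polar derivative would mean
  \<open>p' z / p z = n / (z - \<zeta>)\<close>; then \<open>1 / (z - \<zeta>)\<close> lies in the disc of the preceding lemma, which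
  is the image of the points \<open>\<zeta>\<close> with \<open>Re \<zeta> \<le> a\<close>.
\<close>
lemma polar_derivative_nonzero:
  fixes p :: "complex poly"
  assumes p: "\<And>w. Re w > a \<Longrightarrow> poly p w \<noteq> 0" and deg: "degree p \<le> n" and n: "n > 0"
    and z: "Re z > a" and \<zeta>: "Re \<zeta> > a"
  shows "of_nat n * poly p z + (\<zeta> - z) * poly (pderiv p) z \<noteq> 0"
proof
  assume eq: "of_nat n * poly p z + (\<zeta> - z) * poly (pderiv p) z = 0"
  define W where "W = poly (pderiv p) z / poly p z"
  have pz: "poly p z \<noteq> 0"
    using p z by auto
  have eqW: "(z - \<zeta>) * W = of_nat n"
    using eq pz by (simp add: W_def field_simps)
  then have "W \<noteq> 0"
    using n by (metis mult_zero_right of_nat_0_eq_iff less_numeral_extra(3))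
  then have pos: "0 < (norm W)\<^sup>2"
    by simp
  have disc: "(Re z - a) * (norm W)\<^sup>2 \<le> real (degree p) * Re W"
    unfolding W_def using log_deriv_in_disc p z by blast
  moreover have "0 < (Re z - a) * (norm W)\<^sup>2"
    using z pos by simp
  ultimately have "0 < real (degree p) * Re W"
    by linarith
  then have "real (degree p) * Re W \<le> real n * Re W"
    using deg by (intro mult_right_mono) (auto simp: zero_less_mult_iff)
  also have "\<dots> = Re ((z - \<zeta>) * W * cnj W)"
    unfolding eqW by simp
  also have "\<dots> = Re (z - \<zeta>) * (norm W)\<^sup>2"
    unfolding mult.assoc complex_norm_square[symmetric] by simp
  finally have "(Re z - a) * (norm W)\<^sup>2 \<le> Re (z - \<zeta>) * (norm W)\<^sup>2"
    using disc by linarith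
  then show False
    using pos \<zeta> by simp
qed

definition key_poly :: "nat \<Rightarrow> (nat \<Rightarrow> complex) \<Rightarrow> complex poly" where
  "key_poly n u = (\<Sum>k\<le>n. monom (of_nat (n choose k) * u k) k)"

lemma coeff_key_poly: "coeff (key_poly n u) k = of_nat (n choose k) * u k"
  by (simp add: key_poly_def coeff_sum binomial_eq_0)

lemma poly_key_poly: "poly (key_poly n u) z = (\<Sum>k\<le>n. of_nat (n choose k) * u k * z ^ k)"
  by (simp add: key_poly_def poly_sum poly_monom)

lemma degree_key_poly: "degree (key_poly n u) \<le> n"
  by (rule degree_le) (simp add: coeff_key_poly)

text \<open>
  Fixing one variable of a symmetric multiaffine polynomial to \<open>\<zeta>\<close> changes the coefficients
  \<open>u k\<close> to \<open>u k + \<zeta> * u (Suc k)\<close>; on the diagonal this is the polar derivative.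
\<close>
lemma key_poly_polar:
  "of_nat (Suc n) * poly (key_poly n (\<lambda>k. u k + \<zeta> * u (Suc k))) z =
     of_nat (Suc n) * poly (key_poly (Suc n) u) z
       + (\<zeta> - z) * poly (pderiv (key_poly (Suc n) u)) z"
proof -
  have "smult (of_nat (Suc n)) (key_poly n (\<lambda>k. u k + \<zeta> * u (Suc k))) =
     smult (of_nat (Suc n)) (key_poly (Suc n) u) + [:\<zeta>, -1:] * pderiv (key_poly (Suc n) u)"
  proof (rule poly_eqI)
    fix k
    have 1: "(of_nat (Suc k) * of_nat (Suc n choose Suc k) :: complex) = of_nat (Suc n) * of_nat (n choose k)"
      using Suc_times_binomial_eq[of n k] by (metis of_nat_mult mult.commute)
    have 2: "(of_nat (Suc n) * of_nat (Suc n choose k) - of_nat k * of_nat (Suc n choose k) :: complex)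
               = of_nat (Suc n) * of_nat (n choose k)"
    proof (cases k)
      case (Suc j)
      have "(of_nat (Suc j) * of_nat (Suc n choose Suc j) :: complex) = of_nat (Suc n) * of_nat (n choose j)"
        using Suc_times_binomial_eq[of n j] by (metis of_nat_mult mult.commute)
      then show ?thesis
        unfolding Suc by (simp add: algebra_simps)
    qed simp
    have "coeff (smult (of_nat (Suc n)) (key_poly (Suc n) u) + [:\<zeta>, -1:] * pderiv (key_poly (Suc n) u)) k
        = (of_nat (Suc n) * of_nat (Suc n choose k) - of_nat k * of_nat (Suc n choose k)) * u k
          + (of_nat (Suc k) * of_nat (Suc n choose Suc k)) * \<zeta> * u (Suc k)"
      by (cases k) (simp_all add: coeff_key_poly coeff_pderiv algebra_simps del: of_nat_Suc binomial_Suc_Suc)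
    also have "\<dots> = coeff (smult (of_nat (Suc n)) (key_poly n (\<lambda>k. u k + \<zeta> * u (Suc k)))) k"
      unfolding 1 2 by (simp add: coeff_key_poly algebra_simps del: of_nat_Suc)
    finally show "coeff (smult (of_nat (Suc n)) (key_poly n (\<lambda>k. u k + \<zeta> * u (Suc k)))) k =
      coeff (smult (of_nat (Suc n)) (key_poly (Suc n) u) + [:\<zeta>, -1:] * pderiv (key_poly (Suc n) u)) k"
      by simp
  qed
  from arg_cong[OF this, of "\<lambda>p. poly p z"] show ?thesis
    by (simp add: algebra_simps)
qed

text \<open>
  The variables are fixed one after the other. By \<open>key_poly_polar\<close> each step replaces the diagonal
  polynomial by a polar derivative, which is free of zeros in the half-plane by Laguerre's theorem.
\<close>
lemma grace_walsh_szego_half_plane: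
  fixes x :: "'i \<Rightarrow> complex"
  assumes "finite A"
    and "\<And>z. Re z > a \<Longrightarrow> poly (key_poly (card A) u) z \<noteq> 0"
    and "\<And>i. i \<in> A \<Longrightarrow> Re (x i) > a"
  shows "(\<Sum>S\<in>Pow A. u (card S) * (\<Prod>i\<in>S. x i)) \<noteq> 0"
  using assms
proof (induction A arbitrary: u rule: finite_induct)
  case empty
  have "poly (key_poly 0 u) (of_real (a + 1)) \<noteq> 0"
    using empty(1)[of "of_real (a + 1)"] by simp
  then show ?case
    by (simp add: poly_key_poly)
next
  case (insert j A)
  let ?u = "\<lambda>k. u k + x j * u (Suc k)"
  have "(\<Sum>S\<in>Pow (insert j A). u (card S) * (\<Prod>i\<in>S. x i)) =
      (\<Sum>S\<in>Pow A. u (card S) * (\<Prod>i\<in>S. x i) + u (card (insert j S)) * (\<Prod>i\<in>insert j S. x i))"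
    using insert.hyps by (rule sum_Pow_insert)
  also have "\<dots> = (\<Sum>S\<in>Pow A. ?u (card S) * (\<Prod>i\<in>S. x i))"
  proof (rule sum.cong[OF refl])
    fix S assume "S \<in> Pow A"
    then have "finite S" "j \<notin> S"
      using insert.hyps by (auto intro: finite_subset)
    then show "u (card S) * (\<Prod>i\<in>S. x i) + u (card (insert j S)) * (\<Prod>i\<in>insert j S. x i)
        = ?u (card S) * (\<Prod>i\<in>S. x i)"
      by (simp add: algebra_simps)
  qed
  also have "\<dots> \<noteq> 0"
  proof (rule insert.IH)
    fix z :: complex assume z: "Re z > a"
    have "of_nat (Suc (card A)) * poly (key_poly (card A) ?u) z \<noteq> 0"
      unfolding key_poly_polar
      by (rule polar_derivative_nonzero[where a = a])
        (use insert.prems insert.hyps z degree_key_poly in auto)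
    then show "poly (key_poly (card A) ?u) z \<noteq> 0"
      by auto
  qed (use insert.prems in auto)
  finally show ?case .
qed

section \<open>Asano contraction and Wagner's theorem\<close>
definition multiaffine :: "('i set \<Rightarrow> complex) \<Rightarrow> 'i set \<Rightarrow> ('i \<Rightarrow> complex) \<Rightarrow> complex" where
  "multiaffine c I x = (\<Sum>T\<in>Pow I. c T * (\<Prod>i\<in>T. x i))"

text \<open>
  If \<open>p + s = 0\<close>, then on the diagonal \<open>x = y\<close> the polynomial is a quadratic whose two zeros have
  product \<open>-1\<close>. Since \<open>t\<close> and \<open>- 1 / t\<close> have real parts of opposite signs, one of the zeros has
  a nonnegative real part. The strict inequality \<open>a < 0\<close> is essential: \<open>x + y\<close> does not
  vanish on the open right half-plane, yet its contraction is 0.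
\<close>
lemma asano_scalar:
  fixes p q r s :: complex
  assumes a: "a < 0"
    and nz: "\<And>x y. Re x > a \<Longrightarrow> Re y > a \<Longrightarrow> p + q * x + r * y + s * (x * y) \<noteq> 0"
  shows "p + s \<noteq> 0"
proof
  assume "p + s = 0"
  then have s: "s = - p"
    by (simp add: add_eq_0_iff)
  have p: "p \<noteq> 0"
    using nz[of 0 0] a by simp
  define \<beta> where "\<beta> = (q + r) / p"
  define t where "t = (\<beta> + csqrt (\<beta>\<^sup>2 + 4)) / 2"
  have root: "t * t = \<beta> * t + 1"
  proof -
    have "(csqrt (\<beta>\<^sup>2 + 4))\<^sup>2 = \<beta>\<^sup>2 + 4"
      by simp
    then show ?thesis
      by (simp add: t_def power2_eq_square field_simps)
  qed
  then have t0: "t \<noteq> 0"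
    by auto
  have bp: "q + r = \<beta> * p"
    using p by (simp add: \<beta>_def)
  have no_root: "Re w \<le> a" if "w * w = \<beta> * w + 1" for w
  proof (rule ccontr)
    assume "\<not> Re w \<le> a"
    then have "p + q * w + r * w + s * (w * w) \<noteq> 0"
      using nz by simp
    moreover have "p + q * w + r * w + s * (w * w) = p + (q + r) * w - p * (w * w)"
      by (simp add: s algebra_simps)
    ultimately show False
      unfolding that bp by (simp add: algebra_simps)
  qed
  have "\<beta> = t - inverse t"
    using root t0 by (simp add: field_simps)
  then have "(- inverse t) * (- inverse t) = \<beta> * (- inverse t) + 1"
    using t0 by (simp add: field_simps)
  then have "Re (- inverse t) < 0" "Re t < 0"
    using no_root[of "- inverse t"] no_root[OF root] a by linarith+
  then show False
    using sum_power2_ge_zero[of "Re t" "Im t"] by (auto simp: divide_less_0_iff zero_less_divide_iff)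
qed

lemma asano_contraction:
  assumes a: "a < 0" and J: "finite J" and ij: "i \<noteq> j" "i \<notin> J" "j \<notin> J"
    and nz: "\<And>x. \<forall>k\<in>insert i (insert j J). Re (x k) > a \<Longrightarrow> multiaffine c (insert i (insert j J)) x \<noteq> 0"
    and x: "\<forall>k\<in>J. Re (x k) > a"
  shows "multiaffine (\<lambda>T. c T + c (insert i (insert j T))) J x \<noteq> 0"
proof -
  define p where "p = (\<Sum>T\<in>Pow J. c T * (\<Prod>k\<in>T. x k))"
  define q where "q = (\<Sum>T\<in>Pow J. c (insert i T) * (\<Prod>k\<in>T. x k))"
  define r where "r = (\<Sum>T\<in>Pow J. c (insert j T) * (\<Prod>k\<in>T. x k))"
  define s where "s = (\<Sum>T\<in>Pow J. c (insert i (insert j T)) * (\<Prod>k\<in>T. x k))"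
  have "p + s \<noteq> 0"
  proof (rule asano_scalar[OF a])
    fix v w :: complex assume v: "Re v > a" and w: "Re w > a"
    define y where "y = x(i := v, j := w)"
    have "multiaffine c (insert i (insert j J)) y \<noteq> 0"
      by (rule nz) (use x v w ij in \<open>auto simp: y_def\<close>)
    also have "multiaffine c (insert i (insert j J)) y =
      (\<Sum>T\<in>Pow J. c T * (\<Prod>k\<in>T. y k) + c (insert j T) * (\<Prod>k\<in>insert j T. y k)
         + (c (insert i T) * (\<Prod>k\<in>insert i T. y k)
         + c (insert i (insert j T)) * (\<Prod>k\<in>insert i (insert j T). y k)))"
      unfolding multiaffine_def using ij J
      by (subst sum_Pow_insert, simp, simp, subst sum_Pow_insert, simp, simp) (simp add: add_ac insert_commute)
    also have "\<dots> = (\<Sum>T\<in>Pow J. c T * (\<Prod>k\<in>T. x k) + v * (c (insert i T) * (\<Prod>k\<in>T. x k))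
         + w * (c (insert j T) * (\<Prod>k\<in>T. x k))
         + v * w * (c (insert i (insert j T)) * (\<Prod>k\<in>T. x k)))"
    proof (rule sum.cong[OF refl])
      fix T assume "T \<in> Pow J"
      then have T: "finite T" "i \<notin> T" "j \<notin> T"
        using ij J by (auto intro: finite_subset)
      then have "(\<Prod>k\<in>T. y k) = (\<Prod>k\<in>T. x k)"
        by (intro prod.cong) (auto simp: y_def)
      then show "c T * (\<Prod>k\<in>T. y k) + c (insert j T) * (\<Prod>k\<in>insert j T. y k)
         + (c (insert i T) * (\<Prod>k\<in>insert i T. y k)
         + c (insert i (insert j T)) * (\<Prod>k\<in>insert i (insert j T). y k))
        = c T * (\<Prod>k\<in>T. x k) + v * (c (insert i T) * (\<Prod>k\<in>T. x k))
         + w * (c (insert j T) * (\<Prod>k\<in>T. x k))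
         + v * w * (c (insert i (insert j T)) * (\<Prod>k\<in>T. x k))"
        using T ij by (simp add: y_def algebra_simps)
    qed
    also have "\<dots> = p + q * v + r * w + s * (v * w)"
      by (simp add: sum.distrib sum_distrib_left[symmetric] p_def q_def r_def s_def algebra_simps)
    finally show "p + q * v + r * w + s * (v * w) \<noteq> 0" .
  qed
  then show ?thesis
    by (simp add: multiaffine_def p_def s_def sum.distrib algebra_simps)
qed

text \<open>
  Here \<open>h e\<close> is the pair of half-edges of \<open>e\<close>. The coefficient function is arbitrary so that the
  contraction of one edge can be absorbed into it in the induction.
\<close>
lemma contract_all_edges:
  assumes a: "a < 0" and "finite E"
    and "\<And>e. e \<in> E \<Longrightarrow> card (h e) = 2"
    and "disjoint_family_on h E"
    and "\<And>x. \<forall>k\<in>(\<Union>e\<in>E. h e). Re (x k) > a \<Longrightarrow> multiaffine c (\<Union>e\<in>E. h e) x \<noteq> 0"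
  shows "(\<Sum>F\<in>Pow E. c (\<Union>e\<in>F. h e)) \<noteq> 0"
  using assms(2-)
proof (induction E arbitrary: c rule: finite_induct)
  case empty
  then show ?case
    by (simp add: multiaffine_def)
next
  case (insert e E)
  obtain i j where h: "h e = {i, j}" and ij: "i \<noteq> j"
    using insert.prems(1)[of e] by (auto simp: card_2_iff)
  have disj: "h e \<inter> (\<Union>e\<in>E. h e) = {}"
    using insert.prems(2) insert.hyps by (fastforce simp: disjoint_family_on_def)
  let ?J = "\<Union>e\<in>E. h e" and ?c = "\<lambda>T. c T + c (insert i (insert j T))"
  have J: "(\<Union>e\<in>insert e E. h e) = insert i (insert j ?J)"
    using h by auto
  have finJ: "finite ?J"
    using insert.hyps insert.prems(1) by (intro finite_UN_I) (auto intro: card_ge_0_finite)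
  have "(\<Sum>F\<in>Pow E. ?c (\<Union>e\<in>F. h e)) \<noteq> 0"
  proof (rule insert.IH)
    show "disjoint_family_on h E"
      using insert.prems(2) by (rule disjoint_family_on_mono[rotated]) auto
    show "multiaffine ?c ?J x \<noteq> 0" if "\<forall>k\<in>?J. Re (x k) > a" for x
      using a finJ ij _ _ _ that
    proof (rule asano_contraction)
      show "i \<notin> ?J" "j \<notin> ?J"
        using disj h by auto
      show "multiaffine c (insert i (insert j ?J)) x \<noteq> 0"
        if "\<forall>k\<in>insert i (insert j ?J). Re (x k) > a" for x
        using insert.prems(3)[of x] that unfolding J by blast
    qed
  qed (use insert.prems(1) in auto)
  also have "(\<Sum>F\<in>Pow E. ?c (\<Union>e\<in>F. h e)) = (\<Sum>F\<in>Pow (insert e E). c (\<Union>e\<in>F. h e))"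
    using insert.hyps by (subst sum_Pow_insert) (auto simp: h)
  finally show ?case .
qed

lemma multiaffine_Sigma_prod:
  assumes V: "finite V" and E: "\<And>v. v \<in> V \<Longrightarrow> finite (E v)"
  shows "multiaffine (\<lambda>T. \<Prod>v\<in>V. u v (card {e. (v, e) \<in> T})) (Sigma V E) x =
     (\<Prod>v\<in>V. \<Sum>S\<in>Pow (E v). u v (card S) * (\<Prod>e\<in>S. x (v, e)))"
proof -
  have "(\<Prod>v\<in>V. \<Sum>S\<in>Pow (E v). u v (card S) * (\<Prod>e\<in>S. x (v, e))) =
    (\<Sum>g\<in>PiE V (\<lambda>v. Pow (E v)). \<Prod>v\<in>V. u v (card (g v)) * (\<Prod>e\<in>g v. x (v, e)))"
    using V E by (intro prod_sum_PiE) auto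
  also have "\<dots> = (\<Sum>T\<in>Pow (Sigma V E). (\<Prod>v\<in>V. u v (card {e. (v, e) \<in> T})) * (\<Prod>i\<in>T. x i))"
  proof (rule sum.reindex_bij_witness[where
        i = "\<lambda>T. \<lambda>v\<in>V. {e. (v, e) \<in> T}" and j = "\<lambda>g. Sigma V g"])
    fix g assume g: "g \<in> PiE V (\<lambda>v. Pow (E v))"
    then have fin: "\<forall>v\<in>V. finite (g v)"
      using E by (auto simp: PiE_iff intro: finite_subset)
    have "{e. (v, e) \<in> Sigma V g} = g v" if "v \<in> V" for v
      using that by auto
    moreover have "(\<Prod>i\<in>Sigma V g. x i) = (\<Prod>v\<in>V. \<Prod>e\<in>g v. x (v, e))"
      using prod.Sigma[OF V fin, of "\<lambda>v e. x (v, e)"] by simp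
    ultimately show "(\<Prod>v\<in>V. u v (card {e. (v, e) \<in> Sigma V g})) * (\<Prod>i\<in>Sigma V g. x i)
        = (\<Prod>v\<in>V. u v (card (g v)) * (\<Prod>e\<in>g v. x (v, e)))"
      by (simp add: prod.distrib)
    show "(\<lambda>v\<in>V. {e. (v, e) \<in> Sigma V g}) = g"
      using g by (auto simp: fun_eq_iff PiE_iff extensional_def)
    show "Sigma V g \<in> Pow (Sigma V E)"
      using g by (auto simp: PiE_iff)
  qed (auto simp: PiE_iff)
  finally show ?thesis
    by (simp add: multiaffine_def)
qed

text \<open>
  The half-edges at \<open>v\<close> are the pairs of \<open>v\<close> with an edge at \<open>v\<close>. Before contraction the
  polynomial in the half-edge variables is a product over the vertices, and each factor is the
  symmetric multiaffine polynomial of a key polynomial.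
\<close>
lemma wagner_half_plane:
  fixes G :: "'a ugraph"
  assumes G: "finite_simple_graph G" and a: "a < 0"
    and key: "\<And>v z. v \<in> vertices G \<Longrightarrow> Re z > a \<Longrightarrow> poly (key_poly (vertex_degree G v) (u v)) z \<noteq> 0"
  shows "(\<Sum>F\<in>Pow (edges G). \<Prod>v\<in>vertices G. u v (card {e\<in>F. v \<in> e})) \<noteq> 0"
proof -
  let ?V = "vertices G" and ?E = "edges G"
  have finV: "finite ?V" and E2: "\<And>e. e \<in> ?E \<Longrightarrow> e \<subseteq> ?V \<and> card e = 2"
    using G by (auto simp: finite_simple_graph_def)
  have finE: "finite ?E"
    by (rule finite_subset[of _ "Pow ?V"]) (use finV E2 in auto)
  define h where "h e = (\<lambda>v. (v, e)) ` e" for e :: "'a set"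
  have U: "(\<Union>e\<in>?E. h e) = Sigma ?V (\<lambda>v. {e\<in>?E. v \<in> e})"
    using E2 by (auto simp: h_def)
  let ?c = "\<lambda>T. \<Prod>v\<in>?V. u v (card {e. (v, e) \<in> T})"
  have "(\<Sum>F\<in>Pow ?E. ?c (\<Union>e\<in>F. h e)) \<noteq> 0"
  proof (rule contract_all_edges[OF a finE])
    show "card (h e) = 2" if "e \<in> ?E" for e
      using E2[OF that] by (simp add: h_def card_image inj_on_def)
    show "disjoint_family_on h ?E"
      by (auto simp: disjoint_family_on_def h_def)
    fix x :: "'a \<times> 'a set \<Rightarrow> complex"
    assume x: "\<forall>k\<in>(\<Union>e\<in>?E. h e). Re (x k) > a"
    have "(\<Sum>S\<in>Pow {e\<in>?E. v \<in> e}. u v (card S) * (\<Prod>e\<in>S. x (v, e))) \<noteq> 0" if v: "v \<in> ?V" for v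
    proof (rule grace_walsh_szego_half_plane)
      show "poly (key_poly (card {e\<in>?E. v \<in> e}) (u v)) z \<noteq> 0" if "Re z > a" for z
        using key[OF v that] by (simp add: vertex_degree_def)
      show "Re (x (v, e)) > a" if "e \<in> {e\<in>?E. v \<in> e}" for e
        using x that v unfolding U by auto
    qed (use finE in auto)
    then show "multiaffine ?c (\<Union>e\<in>?E. h e) x \<noteq> 0"
      unfolding U by (subst multiaffine_Sigma_prod) (use finV finE in auto)
  qed
  also have "(\<Sum>F\<in>Pow ?E. ?c (\<Union>e\<in>F. h e)) = (\<Sum>F\<in>Pow ?E. \<Prod>v\<in>?V. u v (card {e\<in>F. v \<in> e}))"
    by (intro sum.cong prod.cong refl arg_cong[where f = "u _"] arg_cong[where f = card])
      (auto simp: h_def)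
  finally show ?thesis .
qed

section \<open>The Ising model on a complete graph\<close>
definition neg_rooted :: "complex poly \<Rightarrow> bool" where
  "neg_rooted p \<longleftrightarrow> (\<forall>z. poly p z = 0 \<longrightarrow> Im z = 0 \<and> Re z < 0)"

lemma neg_rooted_factor:
  assumes "neg_rooted p"
  obtains c rs where "c \<noteq> 0" "length rs = degree p" "\<forall>r\<in>set rs. r > 0"
    "\<And>z. poly p z = c * (\<Prod>r\<leftarrow>rs. z + complex_of_real r)"
proof -
  have "\<exists>c rs. c \<noteq> 0 \<and> length rs = degree p \<and> (\<forall>r\<in>set rs. r > 0) \<and>
    (\<forall>z. poly p z = c * (\<Prod>r\<leftarrow>rs. z + complex_of_real r))"
    using assms
  proof (induction "degree p" arbitrary: p)
    case 0
    then obtain k where p: "p = [:k:]"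
      by (metis degree_eq_zeroE)
    have "k \<noteq> 0"
      using 0(2) by (auto simp: p neg_rooted_def dest: spec[of _ 0])
    then show ?case
      by (intro exI[of _ k] exI[of _ "[]"]) (simp add: p)
  next
    case (Suc m)
    then obtain z where z: "poly p z = 0"
      using fundamental_theorem_of_algebra[of p] by (auto simp: constant_degree)
    then obtain q where p: "p = [:- z, 1:] * q"
      by (metis dvdE poly_eq_0_iff_dvd)
    have "q \<noteq> 0"
      using Suc.hyps(2) p by auto
    then have deg: "degree p = Suc (degree q)"
      unfolding p by (subst degree_mult_eq) auto
    have "neg_rooted q"
      using Suc.prems by (auto simp: neg_rooted_def p)
    then obtain c rs where crs: "c \<noteq> 0" "length rs = degree q" "\<forall>r\<in>set rs. r > 0"
      "\<And>w. poly q w = c * (\<Prod>r\<leftarrow>rs. w + complex_of_real r)"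
      using Suc.hyps deg by (metis Suc_inject)
    have "z = - complex_of_real (- Re z)" "- Re z > 0"
      using Suc.prems z by (auto simp: neg_rooted_def complex_eq_iff)
    then show ?case
      using crs deg by (intro exI[of _ c] exI[of _ "- Re z # rs"]) (auto simp: p algebra_simps)
  qed
  then show ?thesis
    using that by blast
qed

text \<open>
  On a circle around 0, the distance to any fixed negative number increases with the real part.
\<close>
lemma norm_less_on_circle:
  assumes p: "neg_rooted p" and deg: "degree p > 0"
    and norm: "norm v = norm w" and Re: "Re v < Re w"
  shows "norm (poly p v) < norm (poly p w)"
proof -
  obtain c rs where crs: "c \<noteq> 0" "length rs = degree p" "\<forall>r\<in>set rs. r > 0"
    "\<And>z. poly p z = c * (\<Prod>r\<leftarrow>rs. z + complex_of_real r)"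
    using neg_rooted_factor[OF p] by blast
  have lin: "norm (v + complex_of_real r) < norm (w + complex_of_real r)" if "r > 0" for r
  proof -
    have "(norm (x + complex_of_real r))\<^sup>2 = (norm x)\<^sup>2 + 2 * r * Re x + r\<^sup>2" for x
      unfolding cmod_power2 by (simp add: power2_eq_square algebra_simps)
    then have "(norm (v + complex_of_real r))\<^sup>2 < (norm (w + complex_of_real r))\<^sup>2"
      using norm Re that by simp
    then show ?thesis
      by (rule power2_less_imp_less) simp
  qed
  have "norm (\<Prod>r\<leftarrow>rs. v + complex_of_real r) < norm (\<Prod>r\<leftarrow>rs. w + complex_of_real r)"
    if "rs \<noteq> []" "\<forall>r\<in>set rs. r > 0" for rs
    using that
  proof (induction rs rule: list_nonempty_induct)
    case (single r)
    then show ?case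
      using lin by simp
  next
    case (cons r rs)
    then show ?case
      using lin[of r] by (simp add: norm_mult mult_strict_mono')
  qed
  from this[of rs] have "norm (\<Prod>r\<leftarrow>rs. v + complex_of_real r) < norm (\<Prod>r\<leftarrow>rs. w + complex_of_real r)"
    using crs(2,3) deg by (metis list.size(3) less_numeral_extra(3))
  then show ?thesis
    using crs(1) by (simp add: crs(4) norm_mult)
qed

lemma neg_rooted_lower_bound:
  assumes p: "neg_rooted p" and s: "s \<ge> 0"
    and z: "\<And>r. r \<ge> 0 \<Longrightarrow> norm (z + complex_of_real r) \<ge> s * (norm z + r)"
  shows "norm (poly p z) \<ge> s ^ degree p * norm (poly p (complex_of_real (norm z)))"
proof -
  obtain c rs where crs: "c \<noteq> 0" "length rs = degree p" "\<forall>r\<in>set rs. r > 0"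
    "\<And>z. poly p z = c * (\<Prod>r\<leftarrow>rs. z + complex_of_real r)"
    using neg_rooted_factor[OF p] by blast
  have "s ^ length rs * norm (\<Prod>r\<leftarrow>rs. complex_of_real (norm z) + complex_of_real r)
          \<le> norm (\<Prod>r\<leftarrow>rs. z + complex_of_real r)" if "\<forall>r\<in>set rs. r > 0" for rs
    using that
  proof (induction rs)
    case (Cons r rs)
    have "norm (complex_of_real (norm z) + complex_of_real r) = norm z + r"
      using Cons.prems by (simp flip: of_real_add)
    then have "s * norm (complex_of_real (norm z) + complex_of_real r) \<le> norm (z + complex_of_real r)"
      using z[of r] Cons.prems by simp
    from mult_mono[OF this Cons.IH] Cons.prems s show ?case
      by (simp add: norm_mult mult_ac)
  qed simp
  from mult_left_mono[OF this[OF crs(3)], of "norm c"] show ?thesis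
    by (simp add: crs norm_mult algebra_simps)
qed

definition real_coeff_poly :: "nat \<Rightarrow> (nat \<Rightarrow> real) \<Rightarrow> complex poly" where
  "real_coeff_poly d c = (\<Sum>k\<le>d. monom (complex_of_real (c k)) k)"

lemma poly_real_coeff_poly:
  "poly (real_coeff_poly d c) z = (\<Sum>k\<le>d. complex_of_real (c k) * z ^ k)"
  by (simp add: real_coeff_poly_def poly_sum poly_monom)

lemma degree_real_coeff_poly:
  assumes "c d \<noteq> 0"
  shows "degree (real_coeff_poly d c) = d"
proof (rule antisym)
  have co: "coeff (real_coeff_poly d c) k = (if k \<le> d then complex_of_real (c k) else 0)" for k
    by (simp add: real_coeff_poly_def coeff_sum)
  show "degree (real_coeff_poly d c) \<le> d"
    by (rule degree_le) (simp add: co)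
  show "d \<le> degree (real_coeff_poly d c)"
    by (rule le_degree) (simp add: co assms)
qed

lemma real_coeff_poly_of_real:
  "poly (real_coeff_poly d c) (complex_of_real x) = complex_of_real (\<Sum>k\<le>d. c k * x ^ k)"
  by (simp add: poly_real_coeff_poly)

lemma cos_multiple_pos:
  assumes "\<epsilon> \<ge> 0" "real d * \<epsilon> < pi / 2" "k \<le> d"
  shows "cos (real k * \<epsilon>) > 0"
proof (rule cos_gt_zero_pi)
  have "real k * \<epsilon> \<le> real d * \<epsilon>"
    using assms by (intro mult_right_mono) auto
  then show "real k * \<epsilon> < pi / 2"
    using assms by linarith
  have "0 \<le> real k * \<epsilon>"
    using assms by simp
  then show "- (pi / 2) < real k * \<epsilon>"
    using pi_gt_zero by linarith
qed

text \<open>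
  Write \<open>p\<close> for the given polynomial. The new one is the mean of \<open>p\<close> at the two rotations
  of \<open>z\<close> by \<open>\<epsilon>\<close> and \<open>- \<epsilon>\<close>. Unless \<open>z\<close> is real or \<open>\<epsilon> = 0\<close>, these lie on a common circle but have different
  real parts, so the two values of \<open>p\<close> have different norms and cannot cancel. Positive
  coefficients exclude the nonnegative real zeros; this is why \<open>d \<epsilon>\<close> must stay below
  \<open>pi / 2\<close>.
\<close>
lemma neg_rooted_cos_multiplier:
  assumes c: "\<forall>k\<le>d. c k > 0" and nr: "neg_rooted (real_coeff_poly d c)"
    and \<epsilon>: "\<epsilon> \<ge> 0" "real d * \<epsilon> < pi / 2"
  shows "neg_rooted (real_coeff_poly d (\<lambda>k. c k * cos (real k * \<epsilon>)))"
proof (cases "\<epsilon> = 0")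
  case True
  then show ?thesis
    using nr by simp
next
  case False
  have "Im z = 0 \<and> Re z < 0"
    if root: "poly (real_coeff_poly d (\<lambda>k. c k * cos (real k * \<epsilon>))) z = 0" for z
  proof -
    have cpos: "cos (real k * \<epsilon>) > 0" if "k \<le> d" for k
      using cos_multiple_pos[OF \<epsilon> that] .
    have Im: "Im z = 0"
    proof (rule ccontr)
      assume Im: "Im z \<noteq> 0"
      have d: "d > 0"
        using root c Im by (cases d) (auto simp: poly_real_coeff_poly)
      then have \<epsilon>pi: "\<epsilon> < pi"
      proof -
        have "1 * \<epsilon> \<le> real d * \<epsilon>"
          using d \<epsilon> by (intro mult_right_mono) auto
        then show ?thesis
          using \<epsilon> pi_gt_zero by linarith
      qed
      let ?p = "real_coeff_poly d c" and ?u = "cis \<epsilon> * z" and ?w = "cis (- \<epsilon>) * z"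
      have "poly ?p ?u + poly ?p ?w = (\<Sum>k\<le>d. complex_of_real (c k) * z ^ k * (cis (real k * \<epsilon>) + cis (- (real k * \<epsilon>))))"
        by (simp add: poly_real_coeff_poly sum.distrib[symmetric] power_mult_distrib Complex.DeMoivre ring_distribs mult_ac)
      also have "\<dots> = 2 * poly (real_coeff_poly d (\<lambda>k. c k * cos (real k * \<epsilon>))) z"
      proof -
        have "cis t + cis (- t) = 2 * complex_of_real (cos t)" for t
          by (simp add: complex_eq_iff)
        then show ?thesis
          by (simp add: poly_real_coeff_poly sum_distrib_left mult_ac)
      qed
      finally have "poly ?p ?u = - poly ?p ?w"
        using root by (simp add: add_eq_0_iff)
      then have eq: "norm (poly ?p ?u) = norm (poly ?p ?w)"
        by (metis norm_minus_cancel)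
      have deg: "degree ?p > 0"
        using degree_real_coeff_poly[of c d] c d by auto
      have n: "norm ?u = norm ?w"
        by (simp add: norm_mult)
      have "sin \<epsilon> > 0"
        using \<epsilon> False \<epsilon>pi by (simp add: sin_gt_zero)
      then have "Re ?u \<noteq> Re ?w"
        using Im by simp
      then show False
        using norm_less_on_circle[OF nr deg n] norm_less_on_circle[OF nr deg n[symmetric]] eq
        by linarith
    qed
    then obtain x where x: "z = complex_of_real x"
      by (metis complex_is_Real_iff Reals_cases)
    have "x < 0"
    proof (rule ccontr)
      assume "\<not> x < 0"
      then have "(\<Sum>k\<le>d. c k * cos (real k * \<epsilon>) * x ^ k) > 0"
        using c cpos by (intro sum_pos2[where i = 0]) (auto intro!: mult_nonneg_nonneg simp: less_imp_le)
      then show False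
        using root unfolding x real_coeff_poly_of_real of_real_eq_0_iff by simp
    qed
    then show ?thesis
      by (simp add: x)
  qed
  then show ?thesis
    by (simp add: neg_rooted_def)
qed

lemma neg_rooted_cos_power:
  assumes \<epsilon>: "\<epsilon> \<ge> 0" "real d * \<epsilon> < pi / 2"
  shows "neg_rooted (real_coeff_poly d (\<lambda>k. real (d choose k) * cos (real k * \<epsilon>) ^ N))
     \<and> (\<forall>k\<le>d. real (d choose k) * cos (real k * \<epsilon>) ^ N > 0)"
proof (induction N)
  case 0
  have "poly (real_coeff_poly d (\<lambda>k. real (d choose k))) z = (z + 1) ^ d" for z
    by (simp add: poly_real_coeff_poly binomial_ring)
  moreover have "Im z = 0 \<and> Re z < 0" if "z + 1 = 0" for z :: complex
    using that by (simp add: complex_eq_iff)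
  ultimately have "neg_rooted (real_coeff_poly d (\<lambda>k. real (d choose k)))"
    by (auto simp: neg_rooted_def)
  then show ?case
    by simp
next
  case (Suc N)
  then show ?case
    using cos_multiple_pos[OF \<epsilon>] neg_rooted_cos_multiplier[OF _ _ \<epsilon>, of "\<lambda>k. real (d choose k) * cos (real k * \<epsilon>) ^ N"]
    by (simp add: mult_ac)
qed

lemma cos_power_limit:
  "(\<lambda>N. cos (real k * (\<tau> / sqrt (real N))) ^ N) \<longlonglongrightarrow> exp (- (\<tau>\<^sup>2 / 2) * (real k)\<^sup>2)"
proof -
  have "(\<lambda>N. cos (t / sqrt (real N)) ^ N) \<longlonglongrightarrow> exp (- (t\<^sup>2 / 2))" for t :: real
    unfolding power2_eq_square by real_asymp
  from this[of "real k * \<tau>"] show ?thesis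
    by (simp add: power_mult_distrib mult_ac)
qed

text \<open>
  For a polynomial with negative zeros this is \<open>neg_rooted_lower_bound\<close>. The polynomial here is a
  coefficientwise limit of such polynomials, and a non-strict inequality survives the limit.
\<close>
lemma complete_graph_lower_bound:
  fixes b s :: real
  assumes b: "b \<ge> 1" and s: "s \<ge> 0"
    and z: "\<And>r. r \<ge> 0 \<Longrightarrow> norm (z + complex_of_real r) \<ge> s * (norm z + r)"
  shows "norm (\<Sum>k\<le>d. of_nat (d choose k) * complex_of_real b ^ (k * (d - k)) * z ^ k)
      \<ge> s ^ d * (\<Sum>k\<le>d. real (d choose k) * b ^ (k * (d - k)) * norm z ^ k)"
proof -
  \<comment> \<open>with this \<open>\<tau>\<close>, the cosine powers converge to \<open>b powr (- k\<^sup>2)\<close>\<close>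
  define \<tau> where "\<tau> = sqrt (2 * ln b)"
  have \<tau>: "\<tau> \<ge> 0" "\<tau>\<^sup>2 / 2 = ln b"
    using b by (auto simp: \<tau>_def)
  \<comment> \<open>\<open>b ^ (k * (d - k))\<close> is \<open>(b ^ d) ^ k\<close> times \<open>b powr (- k\<^sup>2)\<close>, so the argument is rescaled by \<open>b ^ d\<close>\<close>
  define B where "B = b ^ d"
  have B: "B > 0"
    using b by (simp add: B_def)
  define w where "w = complex_of_real B * z"
  have nw: "norm w = B * norm z"
    using B by (simp add: w_def norm_mult)
  have cone: "norm (w + complex_of_real r) \<ge> s * (norm w + r)" if r: "r \<ge> 0" for r
  proof -
    have "w + complex_of_real r = complex_of_real B * (z + complex_of_real (r / B))"
      using B by (simp add: w_def algebra_simps)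
    then have "norm (w + complex_of_real r) = B * norm (z + complex_of_real (r / B))"
      using B by (simp add: norm_mult)
    moreover have "B * norm (z + complex_of_real (r / B)) \<ge> B * (s * (norm z + r / B))"
      using z[of "r / B"] r B by (intro mult_left_mono) auto
    moreover have "B * (s * (norm z + r / B)) = s * (norm w + r)"
      using B by (simp add: nw algebra_simps)
    ultimately show ?thesis
      by linarith
  qed
  define c where "c N k = real (d choose k) * cos (real k * (\<tau> / sqrt (real N))) ^ N" for N k
  define c' where "c' k = real (d choose k) * exp (- (\<tau>\<^sup>2 / 2) * (real k)\<^sup>2)" for k
  have c'_eq: "c' k * B ^ k = real (d choose k) * b ^ (k * (d - k))" if "k \<le> d" for k
  proof -
    have "exp (ln b * real (k * k)) = b ^ (k * k)"
      using b by (subst exp_of_nat2_mult) auto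
    then have "exp (- (\<tau>\<^sup>2 / 2) * (real k)\<^sup>2) = inverse (b ^ (k * k))"
      unfolding \<tau> by (simp add: exp_minus power2_eq_square)
    moreover have "B ^ k = b ^ (k * (d - k)) * b ^ (k * k)"
      using that unfolding B_def power_mult[symmetric] power_add[symmetric]
      by (simp add: diff_mult_distrib2 mult.commute)
    ultimately show ?thesis
      using b by (simp add: c'_def)
  qed
  have lim: "(\<lambda>N. poly (real_coeff_poly d (c N)) y) \<longlonglongrightarrow> poly (real_coeff_poly d c') y" for y
    unfolding poly_real_coeff_poly c_def c'_def by (intro tendsto_intros cos_power_limit)
  have "(\<lambda>N. real d * (\<tau> / sqrt (real N))) \<longlonglongrightarrow> 0"
    by real_asymp
  then have "eventually (\<lambda>N. real d * (\<tau> / sqrt (real N)) < pi / 2) sequentially"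
    by (rule order_tendstoD) simp
  then have "eventually (\<lambda>N. s ^ d * norm (poly (real_coeff_poly d (c N)) (complex_of_real (norm w)))
      \<le> norm (poly (real_coeff_poly d (c N)) w)) sequentially"
  proof eventually_elim
    case (elim N)
    have "c N = (\<lambda>k. real (d choose k) * cos (real k * (\<tau> / sqrt (real N))) ^ N)"
      by (simp add: c_def fun_eq_iff)
    moreover have "\<tau> / sqrt (real N) \<ge> 0"
      using \<tau>(1) by simp
    ultimately have cN: "neg_rooted (real_coeff_poly d (c N)) \<and> (\<forall>k\<le>d. c N k > 0)"
      using neg_rooted_cos_power[OF _ elim, of N] by simp
    then have pos: "c N d > 0"
      by blast
    have deg: "degree (real_coeff_poly d (c N)) = d"
      using pos by (intro degree_real_coeff_poly) simp
    show ?case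
      using neg_rooted_lower_bound[OF cN[THEN conjunct1] s cone] unfolding deg .
  qed
  then have "s ^ d * norm (poly (real_coeff_poly d c') (complex_of_real (norm w)))
      \<le> norm (poly (real_coeff_poly d c') w)"
    by (intro tendsto_le[OF _ tendsto_norm[OF lim] tendsto_mult[OF tendsto_const tendsto_norm[OF lim]]])
      auto
  also have "poly (real_coeff_poly d c') w =
      (\<Sum>k\<le>d. of_nat (d choose k) * complex_of_real b ^ (k * (d - k)) * z ^ k)"
    unfolding poly_real_coeff_poly
  proof (intro sum.cong refl)
    fix k assume "k \<in> {..d}"
    then have "complex_of_real (c' k * B ^ k) = complex_of_real (real (d choose k) * b ^ (k * (d - k)))"
      using c'_eq by simp
    then show "complex_of_real (c' k) * w ^ k = of_nat (d choose k) * complex_of_real b ^ (k * (d - k)) * z ^ k"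
      by (simp add: w_def power_mult_distrib flip: mult.assoc)
  qed
  also have "norm (poly (real_coeff_poly d c') (complex_of_real (norm w))) =
      (\<Sum>k\<le>d. real (d choose k) * b ^ (k * (d - k)) * norm z ^ k)"
  proof -
    have "(\<Sum>k\<le>d. c' k * norm w ^ k) = (\<Sum>k\<le>d. real (d choose k) * b ^ (k * (d - k)) * norm z ^ k)"
      by (intro sum.cong refl) (simp add: nw power_mult_distrib c'_eq flip: mult.assoc)
    moreover have "0 \<le> (\<Sum>k\<le>d. real (d choose k) * b ^ (k * (d - k)) * norm z ^ k)"
      using b by (intro sum_nonneg) auto
    ultimately show ?thesis
      unfolding real_coeff_poly_of_real norm_of_real by simp
  qed
  finally show ?thesis .
qed

text \<open>
  The parameters whose first \<open>n\<close> powers have relative error less than \<open>\<eta>\<close> with respect to the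
  powers of a single real number \<open>t \<ge> 1\<close>. Relative rather than absolute errors match the termwise
  comparison in \<open>complete_graph_nonzero\<close>.
\<close>
definition edge_region :: "real \<Rightarrow> nat \<Rightarrow> complex set" where
  "edge_region \<eta> n = {b. \<exists>t\<ge>1. \<forall>m\<le>n. norm (b ^ m - complex_of_real t ^ m) < \<eta> * t ^ m}"

lemma open_edge_region: "open (edge_region \<eta> n)"
proof -
  have "edge_region \<eta> n =
      (\<Union>t\<in>{1..}. \<Inter>m\<in>{..n}. {b. norm (b ^ m - complex_of_real t ^ m) < \<eta> * t ^ m})"
    by (auto simp: edge_region_def)
  also have "open \<dots>"
    by (intro open_UN ballI open_INT finite_atMost open_Collect_less continuous_intros)
  finally show ?thesis .
qed

lemma real_ray_subset_edge_region:
  assumes "\<eta> > 0"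
  shows "complex_of_real ` {1..} \<subseteq> edge_region \<eta> n"
proof (intro image_subsetI)
  fix t :: real assume "t \<in> {1..}"
  then show "complex_of_real t \<in> edge_region \<eta> n"
    using assms unfolding edge_region_def by (auto intro!: exI[of _ t])
qed

text \<open>
  Passing from the real parameter \<open>t\<close> to \<open>b\<close> changes each coefficient by a relative error below
  \<open>s ^ \<Delta>\<close>, hence the value at \<open>z\<close> by less than \<open>s ^ \<Delta>\<close> times the value of the real polynomial at
  \<open>norm z\<close>. That is at most the lower bound for its value at \<open>z\<close>.
\<close>
lemma complete_graph_nonzero:
  assumes s: "0 < s" "s \<le> 1" and d: "d \<le> \<Delta>" and b: "b \<in> edge_region (s ^ \<Delta>) (\<Delta> * \<Delta>)"
    and z: "\<And>r. r \<ge> 0 \<Longrightarrow> norm (z + complex_of_real r) \<ge> s * (norm z + r)"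
  shows "(\<Sum>k\<le>d. of_nat (d choose k) * b ^ (k * (d - k)) * z ^ k) \<noteq> 0"
proof
  obtain t where t: "t \<ge> 1" and bt: "\<And>m. m \<le> \<Delta> * \<Delta> \<Longrightarrow> norm (b ^ m - complex_of_real t ^ m) < s ^ \<Delta> * t ^ m"
    using b by (auto simp: edge_region_def)
  have exponent: "k * (d - k) \<le> \<Delta> * \<Delta>" if "k \<le> d" for k
    using that d by (intro mult_le_mono) auto
  let ?K = "\<lambda>b. \<Sum>k\<le>d. of_nat (d choose k) * b ^ (k * (d - k)) * z ^ k"
  assume "?K b = 0"
  then have "norm (?K (complex_of_real t)) = norm (?K b - ?K (complex_of_real t))"
    by simp
  also have "?K b - ?K (complex_of_real t) =
      (\<Sum>k\<le>d. of_nat (d choose k) * (b ^ (k * (d - k)) - complex_of_real t ^ (k * (d - k))) * z ^ k)"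
    unfolding sum_subtractf[symmetric] by (simp add: algebra_simps)
  also have "norm \<dots> \<le>
      (\<Sum>k\<le>d. real (d choose k) * norm (b ^ (k * (d - k)) - complex_of_real t ^ (k * (d - k))) * norm z ^ k)"
    by (rule norm_sum[THEN order_trans]) (simp add: norm_mult norm_power)
  also have "\<dots> < (\<Sum>k\<le>d. real (d choose k) * (s ^ \<Delta> * t ^ (k * (d - k))) * norm z ^ k)"
  proof (rule sum_strict_mono_ex1)
    show "\<forall>k\<in>{..d}. real (d choose k) * norm (b ^ (k * (d - k)) - complex_of_real t ^ (k * (d - k))) * norm z ^ k
        \<le> real (d choose k) * (s ^ \<Delta> * t ^ (k * (d - k))) * norm z ^ k"
      by (intro ballI mult_right_mono mult_left_mono less_imp_le[OF bt] exponent) auto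
    \<comment> \<open>the constant term is strict even for \<open>z = 0\<close>\<close>
    show "\<exists>k\<in>{..d}. real (d choose k) * norm (b ^ (k * (d - k)) - complex_of_real t ^ (k * (d - k))) * norm z ^ k
        < real (d choose k) * (s ^ \<Delta> * t ^ (k * (d - k))) * norm z ^ k"
      using s by (intro bexI[of _ 0]) auto
  qed simp
  also have "\<dots> = s ^ \<Delta> * (\<Sum>k\<le>d. real (d choose k) * t ^ (k * (d - k)) * norm z ^ k)"
    unfolding sum_distrib_left by (simp add: mult_ac)
  also have "\<dots> \<le> s ^ d * (\<Sum>k\<le>d. real (d choose k) * t ^ (k * (d - k)) * norm z ^ k)"
    using s d t by (intro mult_right_mono power_decreasing sum_nonneg) auto
  also have "\<dots> \<le> norm (?K (complex_of_real t))"
    using complete_graph_lower_bound[OF t _ z] s by simp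
  finally show False
    by simp
qed

text \<open>
  For a unit vector \<open>c\<close>, the component of \<open>c y + r\<close> in the direction \<open>c\<close> is
  \<open>Re y + r Re c \<ge> \<sigma> r\<close>. So \<open>r\<close>, and by the triangle inequality also \<open>norm (c y)\<close>, is at most a
  constant times \<open>norm (c y + r)\<close>.
\<close>
lemma rotated_half_plane_cone:
  assumes c: "c \<noteq> 0" "Re c \<ge> \<sigma> * norm c" and \<sigma>: "\<sigma> > 0" and y: "Re y \<ge> 0" and r: "r \<ge> 0"
  shows "norm (c * y + complex_of_real r) \<ge> \<sigma> / (\<sigma> + 2) * (norm (c * y) + r)"
proof -
  let ?N = "norm (c * y + complex_of_real r)"
  have "r * (\<sigma> * norm c) \<le> r * Re c"
    using c r by (intro mult_left_mono) auto
  also have "\<dots> \<le> (norm c)\<^sup>2 * Re y + r * Re c"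
    using y by simp
  also have "\<dots> = Re ((c * y + complex_of_real r) * cnj c)"
    unfolding cmod_power2 by (simp add: power2_eq_square algebra_simps)
  also have "\<dots> \<le> norm ((c * y + complex_of_real r) * cnj c)"
    by (rule complex_Re_le_cmod)
  also have "\<dots> = ?N * norm c"
    by (simp add: norm_mult)
  finally have "(\<sigma> * r) * norm c \<le> ?N * norm c"
    by (simp only: mult_ac)
  then have 1: "\<sigma> * r \<le> ?N"
    by (rule mult_right_le_imp_le) (use c in simp)
  have "norm (c * y) \<le> ?N + r"
    using norm_triangle_ineq4[of "c * y + complex_of_real r" "complex_of_real r"] r by simp
  then have "\<sigma> * (norm (c * y) + r) \<le> \<sigma> * (?N + 2 * r)"
    using \<sigma> by (intro mult_left_mono) auto
  also have "\<dots> \<le> (\<sigma> + 2) * ?N"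
    using 1 by (simp add: algebra_simps)
  finally show ?thesis
    using \<sigma> by (simp add: field_simps)
qed

lemma Re_csqrt_arg_sector:
  assumes z: "z \<in> arg_sector (pi - 2 * \<alpha>)" and \<alpha>: "0 < \<alpha>" "\<alpha> < pi / 2"
  shows "Re (csqrt z) \<ge> sin \<alpha> * norm (csqrt z)"
proof -
  have z0: "z \<noteq> 0" and arg: "\<bar>Im (Ln z)\<bar> < pi - 2 * \<alpha>"
    using z by (auto simp: arg_sector_def Arg_eq_Im_Ln)
  have "sin \<alpha> = cos (pi / 2 - \<alpha>)"
    by (simp add: sin_cos_eq)
  also have "\<dots> \<le> cos \<bar>Im (Ln z) / 2\<bar>"
    using arg \<alpha> by (intro cos_monotone_0_pi_le) auto
  finally have "sin \<alpha> \<le> cos (Im (Ln z) / 2)"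
    by (simp only: cos_abs_real)
  then show ?thesis
    unfolding csqrt_exp_Ln[OF z0] norm_exp_eq_Re Re_exp by (simp add: mult.commute)
qed

lemma finite_polys_margin:
  fixes P :: "complex poly set"
  assumes P: "finite P" and nz: "\<And>p z. p \<in> P \<Longrightarrow> Re z \<ge> 0 \<Longrightarrow> poly p z \<noteq> 0"
  obtains a where "a < 0" "\<And>p z. p \<in> P \<Longrightarrow> Re z > a \<Longrightarrow> poly p z \<noteq> 0"
proof -
  define R where "R = (\<Union>p\<in>P. {z. poly p z = 0})"
  have "p \<noteq> 0" if "p \<in> P" for p
    using nz[OF that, of 0] by auto
  then have fin: "finite R"
    unfolding R_def using P by (intro finite_UN_I poly_roots_finite) auto
  define a where "a = Max (insert (- 1) (Re ` R))"
  have "Re z < 0" if "z \<in> R" for z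
    by (rule ccontr) (use that nz in \<open>auto simp: R_def not_less\<close>)
  then have "a < 0"
    using fin unfolding a_def by (subst Max_less_iff) auto
  moreover have "poly p z \<noteq> 0" if "p \<in> P" "Re z > a" for p z
  proof
    assume "poly p z = 0"
    then have "Re z \<le> a"
      using that fin unfolding a_def by (intro Max_ge) (auto simp: R_def)
    then show False
      using that by simp
  qed
  ultimately show ?thesis
    by (rule that)
qed

section \<open>Line graphs\<close>

text \<open>
  Two distinct edges of a simple graph meet in at most one vertex, so each edge of the line graph
  belongs to the clique of exactly one vertex \<open>v\<close>, and the cut edges can be counted clique by
  clique.
\<close>
lemma card_edge_boundary_line_graph:
  assumes G: "finite_simple_graph G" and F: "F \<subseteq> edges G"
  shows "card (edge_boundary (line_graph G) F) =
    (\<Sum>v\<in>vertices G. card {e\<in>F. v \<in> e} * (vertex_degree G v - card {e\<in>F. v \<in> e}))"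
proof -
  let ?V = "vertices G" and ?E = "edges G"
  have finV: "finite ?V" and E2: "\<And>e. e \<in> ?E \<Longrightarrow> e \<subseteq> ?V \<and> card e = 2"
    using G by (auto simp: finite_simple_graph_def)
  have finE: "finite ?E"
    by (rule finite_subset[of _ "Pow ?V"]) (use finV E2 in auto)
  have finF: "finite F"
    using F finE finite_subset by blast
  define X where "X = Sigma ?V (\<lambda>v. {e\<in>F. v \<in> e} \<times> {f\<in>?E - F. v \<in> f})"
  have "edge_boundary (line_graph G) F = (\<lambda>(v, e, f). {e, f}) ` X"
  proof (intro subset_antisym subsetI)
    fix p assume "p \<in> edge_boundary (line_graph G) F"
    then obtain e f where p: "p = {e, f}" "e \<in> F" "f \<in> ?E - F"
      unfolding edge_boundary_def line_graph_def fst_conv by blast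
    have "p \<in> edges (line_graph G)"
      using \<open>p \<in> edge_boundary (line_graph G) F\<close> by (simp add: edge_boundary_def)
    then obtain e' f' where "p = {e', f'}" "e' \<inter> f' \<noteq> {}"
      unfolding line_graph_def by auto
    with p(1) have "e \<inter> f \<noteq> {}"
      by (auto simp: doubleton_eq_iff)
    then obtain v where v: "v \<in> e" "v \<in> f"
      by auto
    moreover have "v \<in> ?V"
      using E2[of e] v p F by auto
    ultimately have "(v, e, f) \<in> X"
      using p by (auto simp: X_def)
    then show "p \<in> (\<lambda>(v, e, f). {e, f}) ` X"
      using p(1) by (intro image_eqI[of _ _ "(v, e, f)"]) auto
  next
    fix p assume "p \<in> (\<lambda>(v, e, f). {e, f}) ` X"
    then obtain v e f where p: "p = {e, f}" "e \<in> F" "f \<in> ?E" "f \<notin> F" "v \<in> e" "v \<in> f"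
      by (auto simp: X_def)
    then have "e \<in> ?E" "e \<noteq> f" "e \<inter> f \<noteq> {}"
      using F by auto
    then show "p \<in> edge_boundary (line_graph G) F"
      using p unfolding edge_boundary_def line_graph_def by auto
  qed
  moreover have "inj_on (\<lambda>(v, e, f). {e, f}) X"
  proof (rule inj_onI, clarify)
    fix v e f v' e' f'
    assume X: "(v, e, f) \<in> X" "(v', e', f') \<in> X" and eq: "{e, f} = {e', f'}"
    then have ef: "e = e' \<and> f = f'"
      by (auto simp: X_def doubleton_eq_iff)
    have "card e = 2" "card f = 2" "e \<noteq> f" "v \<in> e" "v \<in> f" "v' \<in> e" "v' \<in> f"
      using X ef E2 F by (auto simp: X_def)
    then have "v = v'"
      by (auto simp: card_2_iff)
    then show "v = v' \<and> (e, f) = (e', f')"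
      using ef by simp
  qed
  ultimately have "card (edge_boundary (line_graph G) F) = card X"
    by (simp add: card_image)
  also have "\<dots> = (\<Sum>v\<in>?V. card {e\<in>F. v \<in> e} * card {f\<in>?E - F. v \<in> f})"
    unfolding X_def using finV finE finF by (subst card_SigmaI) (auto simp: card_cartesian_product)
  also have "\<dots> = (\<Sum>v\<in>?V. card {e\<in>F. v \<in> e} * (vertex_degree G v - card {e\<in>F. v \<in> e}))"
  proof (intro sum.cong refl arg_cong2[where f = "(*)"])
    fix v
    have "{f\<in>?E - F. v \<in> f} = {e\<in>?E. v \<in> e} - {e\<in>F. v \<in> e}"
      by auto
    then show "card {f\<in>?E - F. v \<in> f} = vertex_degree G v - card {e\<in>F. v \<in> e}"
      unfolding vertex_degree_def using finF F by (simp add: card_Diff_subset Collect_mono_iff subset_iff)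
  qed
  finally show ?thesis .
qed

lemma handshake:
  assumes G: "finite_simple_graph G" and F: "F \<subseteq> edges G"
  shows "(\<Sum>v\<in>vertices G. card {e\<in>F. v \<in> e}) = 2 * card F"
proof (rule sum_multicount)
  show "finite (vertices G)" "finite F"
    using G F finite_simple_graph_line_graph[OF G]
    by (auto simp: finite_simple_graph_def line_graph_def intro: finite_subset)
  show "\<forall>e\<in>F. card {v\<in>vertices G. v \<in> e} = 2"
  proof
    fix e assume "e \<in> F"
    then have "e \<subseteq> vertices G" "card e = 2"
      using G F by (auto simp: finite_simple_graph_def)
    moreover from this have "{v\<in>vertices G. v \<in> e} = e"
      by auto
    ultimately show "card {v\<in>vertices G. v \<in> e} = 2"
      by simp
  qed
qed

lemma ising_partition_line_graph:
  assumes G: "finite_simple_graph G" and c: "c\<^sup>2 = z"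
  shows "ising_partition (line_graph G) z b =
    (\<Sum>F\<in>Pow (edges G). \<Prod>v\<in>vertices G.
       b ^ (card {e\<in>F. v \<in> e} * (vertex_degree G v - card {e\<in>F. v \<in> e})) * c ^ card {e\<in>F. v \<in> e})"
proof -
  have "ising_partition (line_graph G) z b =
      (\<Sum>F\<in>Pow (edges G). z ^ card F * b ^ card (edge_boundary (line_graph G) F))"
    by (simp add: ising_partition_def line_graph_def)
  also have "\<dots> = (\<Sum>F\<in>Pow (edges G). \<Prod>v\<in>vertices G.
       b ^ (card {e\<in>F. v \<in> e} * (vertex_degree G v - card {e\<in>F. v \<in> e})) * c ^ card {e\<in>F. v \<in> e})"
  proof (rule sum.cong[OF refl])
    fix F assume "F \<in> Pow (edges G)"
    then have F: "F \<subseteq> edges G"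
      by simp
    have "z ^ card F = c ^ (\<Sum>v\<in>vertices G. card {e\<in>F. v \<in> e})"
      unfolding handshake[OF G F] power_mult c ..
    then show "z ^ card F * b ^ card (edge_boundary (line_graph G) F) = (\<Prod>v\<in>vertices G.
       b ^ (card {e\<in>F. v \<in> e} * (vertex_degree G v - card {e\<in>F. v \<in> e})) * c ^ card {e\<in>F. v \<in> e})"
      unfolding card_edge_boundary_line_graph[OF G F] by (simp add: prod.distrib power_sum)
  qed
  finally show ?thesis .
qed


section \<open>Absence of zeros\<close>

text \<open>
  The exponents \<open>k (d - k)\<close> with \<open>d \<le> \<Delta>\<close> are at most \<open>\<Delta> * \<Delta>\<close>, and \<open>sin \<alpha> / (sin \<alpha> + 2)\<close> is the
  constant of \<open>rotated_half_plane_cone\<close> for the directions that \<open>csqrt z\<close> can take.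
\<close>
lemma ising_line_graph_nonzero:
  fixes G :: "'a ugraph"
  assumes \<alpha>: "0 < \<alpha>" "\<alpha> < pi / 2"
    and G: "finite_simple_graph G" "\<forall>v\<in>vertices G. vertex_degree G v \<le> \<Delta>"
    and b: "b \<in> edge_region ((sin \<alpha> / (sin \<alpha> + 2)) ^ \<Delta>) (\<Delta> * \<Delta>)"
    and z: "z \<in> arg_sector (pi - 2 * \<alpha>)"
  shows "ising_partition (line_graph G) z b \<noteq> 0"
proof -
  have \<sigma>: "sin \<alpha> > 0"
    using \<alpha> by (intro sin_gt_zero) auto
  define c where "c = csqrt z"
  have c: "c \<noteq> 0" "c\<^sup>2 = z" "Re c \<ge> sin \<alpha> * norm c"
    using z Re_csqrt_arg_sector[OF z \<alpha>] by (auto simp: c_def arg_sector_def)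
  define u where "u d k = b ^ (k * (d - k)) * c ^ k" for d k
  have nz: "poly (key_poly d (u d)) y \<noteq> 0" if d: "d \<le> \<Delta>" and y: "Re y \<ge> 0" for d y
  proof -
    have "(\<Sum>k\<le>d. of_nat (d choose k) * b ^ (k * (d - k)) * (c * y) ^ k) \<noteq> 0"
      by (rule complete_graph_nonzero[OF _ _ d b])
        (use \<sigma> rotated_half_plane_cone[OF c(1,3) \<sigma> y] in auto)
    then show ?thesis
      by (simp add: poly_key_poly u_def power_mult_distrib mult_ac)
  qed
  obtain a where a: "a < 0"
    "\<And>p y. p \<in> (\<lambda>d. key_poly d (u d)) ` {..\<Delta>} \<Longrightarrow> Re y > a \<Longrightarrow> poly p y \<noteq> 0"
    by (rule finite_polys_margin[of "(\<lambda>d. key_poly d (u d)) ` {..\<Delta>}"]) (use nz in auto)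
  have "(\<Sum>F\<in>Pow (edges G). \<Prod>v\<in>vertices G. u (vertex_degree G v) (card {e\<in>F. v \<in> e})) \<noteq> 0"
    by (rule wagner_half_plane[OF G(1) a(1)]) (use a(2) G(2) in auto)
  then show ?thesis
    by (simp add: ising_partition_line_graph[OF G(1) c(2)] u_def)
qed

theorem theorem1p2:
  fixes \<Delta> :: nat and \<alpha> :: real
  assumes "\<Delta> \<ge> 2" and "0 < \<alpha>" and "\<alpha> < pi / 2"
  shows "\<exists>U :: complex set. open U \<and> complex_of_real ` {1..} \<subseteq> U \<and>
    (\<forall>G :: 'a ugraph. finite_simple_graph G \<and> (\<forall>v \<in> vertices G. vertex_degree G v \<le> \<Delta>) \<longrightarrow>
       (\<forall>b \<in> U. \<forall>z \<in> arg_sector (pi - 2 * \<alpha>). ising_partition (line_graph G) z b \<noteq> 0) \<and>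
       (\<forall>b \<in> U. ising_partition (line_graph G) 1 b \<noteq> 0))"
proof -
  let ?U = "edge_region ((sin \<alpha> / (sin \<alpha> + 2)) ^ \<Delta>) (\<Delta> * \<Delta>)"
  have "sin \<alpha> > 0"
    using assms by (intro sin_gt_zero) auto
  then have "complex_of_real ` {1..} \<subseteq> ?U"
    by (intro real_ray_subset_edge_region) simp
  moreover have "1 \<in> arg_sector (pi - 2 * \<alpha>)"
    using assms(3) by (simp add: arg_sector_def)
  ultimately show ?thesis
    using open_edge_region ising_line_graph_nonzero[OF assms(2,3)] by (intro exI[of _ ?U]) blast
qed

end
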